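(* In the screening model described in the context, suppose the conditions of limited feasible recourse ($\bar r<a_L/\delta$ and $K_L(\bar r)<v$) and acceptance dominance at the top ($q_H(r)(a_H+\delta r)\le a_H$ for every $r\in\mathcal R$) hold. Fix a posterior $p\in(\underline p,\bar p)$ at which the optimal requirement $r^*(p)$, i.e. the maximizer of $U^O(p,\cdot)$ over $\mathcal R$, is unique and lies in $(\underline r,\bar r)$, and suppose that the second derivative of $U^O$ with respect to $r$ satisfies $U^O_{rr}(p,r^*(p))<0$. Then, holding $p$ and all other primitives fixed, a marginal increase in productivity $\delta$ raises the optimal requirement ($\partial r^*(p)/\partial\delta>0$) if $$p\,a_HK_H'(r^*(p))>(1-p)\,a_LK_L'(r^*(p)),$$ and lowers it ($\partial r^*(p)/\partial\delta<0$) if the inequality is reversed. If the two sides are equal, then $\partial r^*(p)/\partial\delta=0$.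
   Context: Primitives: real numbers $a_H>0$, $a_L>0$, $v>0$, $\delta>0$, $\bar\varepsilon>0$; a compact interval $\mathcal R=[\underline r,\bar r]$ with $0<\underline r\le\bar r$; for each type $\theta\in\{H,L\}$ a twice differentiable function $K_\theta:\mathcal R\to\mathbb R$ with $K_\theta\ge 0$, $K_\theta'>0$, $K_\theta''\ge 0$ on $\mathcal R$ (derivatives one-sided at endpoints), and $K_H(r)\le K_L(r)$ for all $r\in\mathcal R$. Completion probabilities (the probability that $K_\theta(r)+\varepsilon\le v$ when $\varepsilon$ is uniform on $[0,\bar\varepsilon]$): $$q_\theta(r)=\min\left\{\max\left\{\frac{v-K_\theta(r)}{\bar\varepsilon},0\right\},1\right\}.$$ At posterior belief $p\in[0,1]$ (the probability that the applicant is of type $H$), the principal chooses one of: accept ($A$), reject ($R$), or offer recourse with some requirement $r\in\mathcal R$ ($(O,r)$). The payoffs are $$U^A(p)=pa_H-(1-p)a_L,\qquad U^R=0,\qquad U^O(p,r)=p\,q_H(r)(a_H+\delta r)+(1-p)\,q_L(r)(-a_L+\delta r).$$ Let $V^O(p)=\max_{r\in\mathcal R}U^O(p,r)$. Tie-broken optimal action at $p$: accept if $U^A(p)\ge\max\{0,V^O(p)\}$; otherwise offer recourse with a requirement $r^*(p)\in\arg\max_{r\in\mathcal R}U^O(p,r)$ if $V^O(p)\ge 0$; otherwise reject. Cutoffs: let $p^A=a_L/(a_H+a_L)$. Under limited feasible recourse and acceptance dominance at the top, there are unique numbers $0<\underline p<p^A<\bar p\le1$ such that the tie-broken optimal action is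 rejection exactly on $[0,\underline p)$, recourse exactly on $[\underline p,\bar p)$, and acceptance exactly on $[\bar p,1]$. Derivative convention: $\partial r^*(p)/\partial\delta$ is the derivative at the given $\delta$ of $\delta'\mapsto r^*(p;\delta')$, where $r^*(p;\delta')$ is a maximizer over $\mathcal R$ of $U^O(p,\cdot)$ computed with productivity $\delta'$; only $\delta'$ near $\delta$ for which limited feasible recourse and acceptance dominance at the top continue to hold are considered. *)

theory Defs
  imports "HOL-Analysis.Analysis"
begin

datatype applicant_type = H | L

datatype action = Accept | Reject | Offer real

text \<open>
  Correspondence with the usual symbols: \<open>gain\<close> is $a_H$, \<open>loss\<close> is $a_L$, \<open>benefit\<close> is $v$,
  \<open>productivity\<close> is $\delta$, \<open>noise\<close> is $\bar\varepsilon$, \<open>r_lo\<close> and \<open>r_hi\<close> are the endpoints of the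
  requirement set, and \<open>cost t\<close> is $K_t$.
\<close>

record primitives =
  gain :: real
  loss :: real
  benefit :: real
  productivity :: real
  noise :: real
  r_lo :: real
  r_hi :: real
  cost :: "applicant_type \<Rightarrow> real \<Rightarrow> real"

definition requirements :: "primitives \<Rightarrow> real set" where
  "requirements M = {r_lo M..r_hi M}"

text \<open>
  Only the values of \<open>cost t\<close> on the requirement set matter; the derivatives \<open>K1\<close> and \<open>K2\<close> are taken
  within that set, hence are one-sided at its endpoints.
\<close>

definition screening_model :: "primitives \<Rightarrow> bool" where
  "screening_model M \<longleftrightarrow>
     gain M > 0 \<and> loss M > 0 \<and> benefit M > 0 \<and> productivity M > 0 \<and> noise M > 0 \<and>
     0 < r_lo M \<and> r_lo M \<le> r_hi M \<and>
     (\<forall>t. \<exists>K1 K2. \<forall>r\<in>requirements M.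
        (cost M t has_real_derivative K1 r) (at r within requirements M) \<and>
        (K1 has_real_derivative K2 r) (at r within requirements M) \<and>
        cost M t r \<ge> 0 \<and> K1 r > 0 \<and> K2 r \<ge> 0) \<and>
     (\<forall>r\<in>requirements M. cost M H r \<le> cost M L r)"

definition completion_prob :: "primitives \<Rightarrow> applicant_type \<Rightarrow> real \<Rightarrow> real" where
  "completion_prob M t r = min (max ((benefit M - cost M t r) / noise M) 0) 1"

definition U_accept :: "primitives \<Rightarrow> real \<Rightarrow> real" where
  "U_accept M p = p * gain M - (1 - p) * loss M"

definition U_offer :: "primitives \<Rightarrow> real \<Rightarrow> real \<Rightarrow> real" where
  "U_offer M p r =
     p * completion_prob M H r * (gain M + productivity M * r) +
     (1 - p) * completion_prob M L r * (- loss M + productivity M * r)"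

text \<open>In a screening model the supremum is attained, since \<open>U_offer M p\<close> is continuous on a compact interval.\<close>

definition V_offer :: "primitives \<Rightarrow> real \<Rightarrow> real" where
  "V_offer M p = (SUP r\<in>requirements M. U_offer M p r)"

definition optimal_requirement :: "primitives \<Rightarrow> real \<Rightarrow> real \<Rightarrow> bool" where
  "optimal_requirement M p r \<longleftrightarrow> is_arg_max (U_offer M p) (\<lambda>s. s \<in> requirements M) r"

text \<open>Ties are broken in favour of acceptance, then recourse.\<close>

definition optimal_action :: "primitives \<Rightarrow> real \<Rightarrow> action \<Rightarrow> bool" where
  "optimal_action M p a \<longleftrightarrow>
     (if U_accept M p \<ge> max 0 (V_offer M p) then a = Accept
      else if V_offer M p \<ge> 0 then \<exists>r. a = Offer r \<and> optimal_requirement M p r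
      else a = Reject)"

definition limited_feasible_recourse :: "primitives \<Rightarrow> bool" where
  "limited_feasible_recourse M \<longleftrightarrow>
     r_hi M < loss M / productivity M \<and> cost M L (r_hi M) < benefit M"

definition acceptance_dominance :: "primitives \<Rightarrow> bool" where
  "acceptance_dominance M \<longleftrightarrow>
     (\<forall>r\<in>requirements M. completion_prob M H r * (gain M + productivity M * r) \<le> gain M)"

definition p_accept :: "primitives \<Rightarrow> real" where
  "p_accept M = loss M / (gain M + loss M)"

definition cutoffs :: "primitives \<Rightarrow> real \<Rightarrow> real \<Rightarrow> bool" where
  "cutoffs M p_lo p_hi \<longleftrightarrow>
     0 < p_lo \<and> p_lo < p_accept M \<and> p_accept M < p_hi \<and> p_hi \<le> 1 \<and>
     (\<forall>p\<in>{0..1}.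
        (optimal_action M p Reject \<longleftrightarrow> p < p_lo) \<and>
        ((\<exists>r. optimal_action M p (Offer r)) \<longleftrightarrow> p_lo \<le> p \<and> p < p_hi) \<and>
        (optimal_action M p Accept \<longleftrightarrow> p_hi \<le> p))"

text \<open>
  The productivities over which comparative statics are taken. Both conditions are inherited by
  smaller positive productivities, so if they hold at \<open>M\<close>, this set contains
  \<open>{0<..productivity M}\<close>, and derivatives at \<open>productivity M\<close> within it are unique. Acceptance
  dominance may bind at \<open>productivity M\<close>, in which case such a derivative is a left derivative.
\<close>

definition admissible_productivities :: "primitives \<Rightarrow> real set" where
  "admissible_productivities M =
     {d. d > 0 \<and> limited_feasible_recourse (M\<lparr>productivity := d\<rparr>) \<and>
         acceptance_dominance (M\<lparr>productivity := d\<rparr>)}"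

end

theory Submission
  imports Defs
begin

text \<open>
  If $q_H(r^*) = 1$, then $U^O(p,\cdot)$ has slope at least $p\,\delta$ to the left of $r^*$, which is
  impossible at an interior maximizer where it is differentiable. Hence $0 < q_H, q_L < 1$ near $r^*$,
  and there $U^O_r = B(r) + \delta A(r)$ with
  $\bar\varepsilon A = p\,(v - K_H - r K_H') + (1-p)(v - K_L - r K_L')$ and
  $\bar\varepsilon B = (1-p)\,a_L K_L' - p\,a_H K_H'$. Since $r^*$ is the unique maximizer, $r^*(\delta')$
  tends to it, so the first-order condition persists and gives $\partial r^*/\partial\delta = - A / U^O_{rr}$.
  The first-order condition at $\delta$ reads $\delta A = - B$, which determines the sign.
\<close>

section \<open>General analysis: stability of maximizers, implicit equations, left slopes\<close>

text \<open>By compactness, \<open>f\<close> on \<open>S - N\<close> stays a fixed gap below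
  \<open>f x0\<close>, and a uniform error below half that gap cannot make a point there beat
  \<open>x0\<close>.\<close>

lemma argmax_tendsto:
  fixes f :: "'a::topological_space \<Rightarrow> real" and g :: "'d \<Rightarrow> 'a \<Rightarrow> real"
  assumes S: "compact S" and f: "continuous_on S f"
    and max: "\<And>s. s \<in> S \<Longrightarrow> s \<noteq> x0 \<Longrightarrow> f s < f x0" and x0: "x0 \<in> S"
    and lim: "uniform_limit S g f F"
    and x: "\<forall>\<^sub>F d in F. x d \<in> S \<and> (\<forall>s\<in>S. g d s \<le> g d (x d))"
  shows "(x \<longlongrightarrow> x0) F"
proof (rule topological_tendstoI)
  fix N assume N: "open N" "x0 \<in> N"
  show "\<forall>\<^sub>F d in F. x d \<in> N"
  proof (cases "S - N = {}")
    case True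
    then show ?thesis using x by (auto elim!: eventually_mono)
  next
    case False
    have "compact (S - N)" using S N by (simp add: compact_diff)
    moreover have "continuous_on (S - N) f" using f by (rule continuous_on_subset) auto
    ultimately obtain m where m: "m \<in> S - N" "\<And>s. s \<in> S - N \<Longrightarrow> f s \<le> f m"
      using continuous_attains_sup[of "S - N" f] False by blast
    define e where "e = (f x0 - f m) / 2"
    have e: "e > 0" using max[of m] m(1) N by (auto simp: e_def)
    have "\<forall>\<^sub>F d in F. \<forall>s\<in>S. dist (g d s) (f s) < e"
      using lim e by (auto simp: uniform_limit_iff)
    with x show ?thesis
    proof eventually_elim
      case (elim d)
      show "x d \<in> N"
      proof (rule ccontr)
        assume "x d \<notin> N"
        then have "f (x d) \<le> f m" using elim m(2) by auto
        moreover have "g d x0 \<le> g d (x d)" "\<bar>g d x0 - f x0\<bar> < e" "\<bar>g d (x d) - f (x d)\<bar> < e"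
          using elim x0 by (auto simp: dist_real_def)
        ultimately show False unfolding e_def abs_less_iff by argo
      qed
    qed
  qed
qed

text \<open>Caratheodory's factorization \<open>f z = g z * (z - x d0)\<close>, with
  \<open>g\<close> continuous at \<open>x d0\<close> and of value \<open>c\<close> there, makes the
  difference quotient of \<open>x\<close> equal to \<open>- A (x d) / g (x d)\<close> near
  \<open>d0\<close>. Continuity of \<open>x\<close> at \<open>d0\<close> within \<open>S\<close>
  thus already yields its derivative.\<close>

lemma implicit_has_real_derivative:
  fixes f A x :: "real \<Rightarrow> real"
  assumes f: "(f has_real_derivative c) (at (x d0))" and c: "c \<noteq> 0" and f0: "f (x d0) = 0"
    and A: "isCont A (x d0)" and x: "(x \<longlongrightarrow> x d0) (at d0 within S)"
    and eq: "\<forall>\<^sub>F d in at d0 within S. f (x d) + (d - d0) * A (x d) = 0"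
  shows "(x has_real_derivative - A (x d0) / c) (at d0 within S)"
proof -
  obtain g where g: "\<And>z. f z - f (x d0) = g z * (z - x d0)" "isCont g (x d0)" "g (x d0) = c"
    using f unfolding CARAT_DERIV by blast
  have lim_g: "((\<lambda>d. g (x d)) \<longlongrightarrow> c) (at d0 within S)"
    using isCont_tendsto_compose[OF g(2) x] g(3) by simp
  have lim: "((\<lambda>d. - A (x d) / g (x d)) \<longlongrightarrow> - A (x d0) / c) (at d0 within S)"
    by (intro tendsto_intros isCont_tendsto_compose[OF A x] lim_g c)
  have "\<forall>\<^sub>F d in at d0 within S. g (x d) \<noteq> 0"
    using lim_g c by (rule tendsto_imp_eventually_ne)
  moreover have "\<forall>\<^sub>F d in at d0 within S. d \<noteq> d0"
    by (simp add: eventually_at_filter)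
  ultimately have "\<forall>\<^sub>F d in at d0 within S. - A (x d) / g (x d) = (x d - x d0) / (d - d0)"
    using eq
  proof eventually_elim
    case (elim d)
    have "(x d - x d0) * g (x d) = - A (x d) * (d - d0)"
      using g(1)[of "x d"] elim(3) f0 by (simp add: algebra_simps)
    then show ?case using elim(1,2) by (simp add: field_simps)
  qed
  from Lim_transform_eventually[OF lim this]
  show ?thesis by (simp add: has_field_derivative_iff)
qed

text \<open>The left difference quotients are at least \<open>c\<close>, and so is their limit. This
  serves where the payoff is controlled only to the left of a point, at the cap
  \<open>q_H = 1\<close>.\<close>

lemma deriv_ge_left_slope:
  fixes f :: "real \<Rightarrow> real"
  assumes f: "(f has_real_derivative D) (at x)" and "a < x"
    and slope: "\<And>y. a < y \<Longrightarrow> y < x \<Longrightarrow> f x - f y \<ge> c * (x - y)"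
  shows "D \<ge> c"
proof (rule tendsto_lowerbound)
  show "((\<lambda>y. (f y - f x) / (y - x)) \<longlongrightarrow> D) (at_left x)"
    using has_field_derivative_at_within[OF f] by (simp add: has_field_derivative_iff)
  have "\<forall>\<^sub>F y in at_left x. y \<in> {a<..<x}"
    using \<open>a < x\<close> by (rule eventually_at_left_real)
  then show "\<forall>\<^sub>F y in at_left x. c \<le> (f y - f x) / (y - x)"
  proof eventually_elim
    case (elim y)
    then show ?case using slope[of y] by (simp add: le_divide_eq algebra_simps)
  qed
qed simp

section \<open>Costs and completion probabilities\<close>

context
  fixes M :: primitives
  assumes model: "screening_model M"
begin

lemma primitives_pos:
  "gain M > 0" "loss M > 0" "productivity M > 0" "noise M > 0" "0 < r_lo M"
  using model by (auto simp: screening_model_def)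

lemma cost_le: "r \<in> requirements M \<Longrightarrow> cost M H r \<le> cost M L r"
  using model by (auto simp: screening_model_def)

lemma continuous_on_cost: "continuous_on (requirements M) (cost M t)"
  using model unfolding screening_model_def
  by (metis DERIV_continuous_on)

text \<open>At interior points the derivative within the requirement set is two-sided; continuity of
  \<open>K1\<close> comes from its own derivative \<open>K2\<close>.\<close>

lemma cost_derivE:
  obtains K1 where
    "\<And>r. r \<in> {r_lo M<..<r_hi M} \<Longrightarrow> (cost M t has_real_derivative K1 r) (at r)"
    "\<And>r. r \<in> {r_lo M<..<r_hi M} \<Longrightarrow> isCont K1 r"
    "\<And>r. r \<in> {r_lo M<..<r_hi M} \<Longrightarrow> K1 r > 0"
proof -
  obtain K1 K2 where K: "\<And>r. r \<in> requirements M \<Longrightarrow>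
      (cost M t has_real_derivative K1 r) (at r within requirements M) \<and>
      (K1 has_real_derivative K2 r) (at r within requirements M) \<and> K1 r > 0"
    using model unfolding screening_model_def by metis
  have "at r within requirements M = at r" "r \<in> requirements M"
    if "r \<in> {r_lo M<..<r_hi M}" for r
    using that by (auto simp: requirements_def at_within_Icc_at)
  with K show ?thesis
    by (intro that[of K1]) (metis DERIV_isCont)+
qed

text \<open>Positive slope in the interior gives monotonicity, and continuity on the closed interval
  extends it to the endpoints.\<close>

lemma cost_mono:
  assumes "r \<in> requirements M" "s \<in> requirements M" "r \<le> s"
  shows "cost M t r \<le> cost M t s"
proof (cases "r < s")
  case True
  obtain K1 where K:
    "\<And>r. r \<in> {r_lo M<..<r_hi M} \<Longrightarrow> (cost M t has_real_derivative K1 r) (at r)"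
    "\<And>r. r \<in> {r_lo M<..<r_hi M} \<Longrightarrow> K1 r > 0"
    by (rule cost_derivE) blast
  have "continuous_on {r..s} (cost M t)"
    using continuous_on_cost by (rule continuous_on_subset) (use assms in \<open>auto simp: requirements_def\<close>)
  moreover have "\<exists>y. (cost M t has_real_derivative y) (at z) \<and> y > 0" if "r < z" "z < s" for z
    using K[of z] that assms by (auto simp: requirements_def)
  ultimately show ?thesis
    using DERIV_pos_imp_increasing_open[OF True] by (metis less_imp_le)
qed (use assms in simp)

lemma completion_prob_bounds: "0 \<le> completion_prob M t r" "completion_prob M t r \<le> 1"
  by (auto simp: completion_prob_def)

lemma completion_prob_antimono:
  assumes "r \<in> requirements M" "s \<in> requirements M" "r \<le> s"
  shows "completion_prob M t s \<le> completion_prob M t r"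
proof -
  have "(benefit M - cost M t s) / noise M \<le> (benefit M - cost M t r) / noise M"
    using cost_mono[OF assms] primitives_pos by (intro divide_right_mono) auto
  then show ?thesis by (auto simp: completion_prob_def)
qed

section \<open>The offer payoff as a function of requirement and productivity\<close>

lemma continuous_on_U_offer: "continuous_on (requirements M) (U_offer M p)"
  unfolding U_offer_def completion_prob_def
  by (intro continuous_intros continuous_on_cost) (use primitives_pos in auto)

text \<open>Completion probabilities do not involve productivity, so the payoff is affine in
  it.\<close>

lemma U_offer_productivity:
  "U_offer (M\<lparr>productivity := d\<rparr>) p r = U_offer M p r +
     (d - productivity M) * (r * (p * completion_prob M H r + (1 - p) * completion_prob M L r))"
  by (simp add: U_offer_def completion_prob_def algebra_simps)

text \<open>The coefficient of \<open>d - productivity M\<close> is \<open>r\<close> times an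
  average of two probabilities, hence at most \<open>r_hi M\<close> in absolute value for every
  feasible \<open>r\<close>.\<close>

lemma uniform_limit_U_offer:
  assumes "0 \<le> p" "p \<le> 1"
  shows "uniform_limit (requirements M) (\<lambda>d. U_offer (M\<lparr>productivity := d\<rparr>) p) (U_offer M p)
    (at (productivity M) within D)"
proof (rule uniform_limitI)
  fix e :: real assume "e > 0"
  have b: "\<bar>r * (p * completion_prob M H r + (1 - p) * completion_prob M L r)\<bar> \<le> r_hi M"
    if "r \<in> requirements M" for r
  proof -
    have r: "0 \<le> r" "r \<le> r_hi M" using that primitives_pos by (auto simp: requirements_def)
    have "p * completion_prob M H r + (1 - p) * completion_prob M L r \<le> p * 1 + (1 - p) * 1"
      using assms completion_prob_bounds by (intro add_mono mult_left_mono) auto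
    moreover have "0 \<le> p * completion_prob M H r + (1 - p) * completion_prob M L r"
      using assms completion_prob_bounds by simp
    ultimately have "\<bar>p * completion_prob M H r + (1 - p) * completion_prob M L r\<bar> \<le> 1" by simp
    then have "\<bar>r\<bar> * \<bar>p * completion_prob M H r + (1 - p) * completion_prob M L r\<bar> \<le> r * 1"
      using r by (intro mult_mono) auto
    then show ?thesis using r by (simp add: abs_mult)
  qed
  have "((\<lambda>d. \<bar>d - productivity M\<bar> * r_hi M) \<longlongrightarrow> \<bar>productivity M - productivity M\<bar> * r_hi M)
      (at (productivity M) within D)"
    by (intro tendsto_intros)
  then have "\<forall>\<^sub>F d in at (productivity M) within D. \<bar>d - productivity M\<bar> * r_hi M < e"
    using \<open>e > 0\<close> by (intro order_tendstoD(2)) auto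
  then show "\<forall>\<^sub>F d in at (productivity M) within D. \<forall>r\<in>requirements M.
      dist (U_offer (M\<lparr>productivity := d\<rparr>) p r) (U_offer M p r) < e"
  proof eventually_elim
    case (elim d)
    show ?case
    proof
      fix r assume "r \<in> requirements M"
      then have "\<bar>d - productivity M\<bar> * \<bar>r * (p * completion_prob M H r + (1 - p) * completion_prob M L r)\<bar>
          \<le> \<bar>d - productivity M\<bar> * r_hi M"
        by (intro mult_left_mono b) auto
      then show "dist (U_offer (M\<lparr>productivity := d\<rparr>) p r) (U_offer M p r) < e"
        using elim by (simp add: U_offer_productivity dist_real_def flip: abs_mult)
    qed
  qed
qed

lemma optimal_requirement_iff:
  "optimal_requirement (M\<lparr>productivity := d\<rparr>) p r \<longleftrightarrow> r \<in> requirements M \<and>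
    (\<forall>s\<in>requirements M. U_offer (M\<lparr>productivity := d\<rparr>) p s \<le> U_offer (M\<lparr>productivity := d\<rparr>) p r)"
  by (auto simp: optimal_requirement_def is_arg_max_linorder requirements_def)

lemma optimal_requirement_iff':
  "optimal_requirement M p r \<longleftrightarrow> r \<in> requirements M \<and>
    (\<forall>s\<in>requirements M. U_offer M p s \<le> U_offer M p r)"
  using optimal_requirement_iff[of "productivity M" p r] by simp

section \<open>Interior maximizers and the region without truncation\<close>

lemma interior_argmax_deriv_0:
  assumes "(f has_real_derivative D) (at r)" "r \<in> {r_lo M<..<r_hi M}"
    and "\<And>s. s \<in> requirements M \<Longrightarrow> f s \<le> f r"
  shows "D = 0"
proof (rule DERIV_local_max[OF assms(1)])
  show "0 < min (r - r_lo M) (r_hi M - r)" using assms(2) by auto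
  show "\<forall>y. \<bar>r - y\<bar> < min (r - r_lo M) (r_hi M - r) \<longrightarrow> f y \<le> f r"
    using assms(3) by (auto simp: requirements_def abs_less_iff)
qed

text \<open>The strict inequality also excludes the kink
  \<open>cost M H r = benefit M - noise M\<close>. A maximizer there could have a positive left
  slope; differentiability at \<open>r\<close> rules this out, since the slope must then be
  \<open>0\<close>.\<close>

lemma optimal_requirement_cost_gt:
  assumes lfr: "limited_feasible_recourse M" and p: "0 < p" "p < 1"
    and opt: "optimal_requirement M p r" and r: "r \<in> {r_lo M<..<r_hi M}"
    and diff: "U_offer M p differentiable (at r)"
  shows "cost M H r > benefit M - noise M"
proof (rule ccontr)
  assume "\<not> ?thesis"
  then have le: "cost M H r \<le> benefit M - noise M" by simp
  note pos = primitives_pos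
  obtain D where D: "(U_offer M p has_real_derivative D) (at r)"
    using diff by (auto simp: real_differentiable_def)
  have r': "r \<in> requirements M" using r by (auto simp: requirements_def)
  have q1: "completion_prob M H s = 1" if "s \<in> requirements M" "s \<le> r" for s
  proof -
    have "1 \<le> (benefit M - cost M H s) / noise M"
      using cost_mono[OF that(1) r' that(2), of H] le pos by (simp add: le_divide_eq)
    then show ?thesis by (simp add: completion_prob_def)
  qed
  have "p * productivity M \<le> D"
  proof (rule deriv_ge_left_slope[OF D, of "r_lo M"])
    fix s assume s: "r_lo M < s" "s < r"
    then have s': "s \<in> requirements M" using r by (auto simp: requirements_def)
    \<comment> \<open>Limited feasible recourse keeps \<open>loss M - productivity M * r\<close>
      positive, so the expected loss from type \<open>L\<close> is a product of nonnegative factors,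
      neither of which increases with the requirement. Type \<open>H\<close> alone contributes
      \<open>p * productivity M * (r - s)\<close>.\<close>
    have "productivity M * r_hi M < loss M"
      using lfr pos by (simp add: limited_feasible_recourse_def less_divide_eq mult.commute)
    moreover have "productivity M * r \<le> productivity M * r_hi M" "productivity M * s \<le> productivity M * r"
      using pos s r by (auto intro!: mult_left_mono)
    ultimately have "completion_prob M L r * (loss M - productivity M * r)
        \<le> completion_prob M L s * (loss M - productivity M * s)"
      using completion_prob_antimono[OF s' r', of L] s completion_prob_bounds
      by (intro mult_mono) auto
    then have "(1 - p) * (completion_prob M L r * (loss M - productivity M * r))
        \<le> (1 - p) * (completion_prob M L s * (loss M - productivity M * s))"
      using p by (intro mult_left_mono) auto
    then show "p * productivity M * (r - s) \<le> U_offer M p r - U_offer M p s"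
      using q1[OF s'] q1[OF r'] s by (simp add: U_offer_def algebra_simps)
  qed (use r in auto)
  moreover have "D = 0"
    using interior_argmax_deriv_0[OF D r] opt by (auto simp: optimal_requirement_iff')
  ultimately show False using p pos by (simp add: mult_le_0_iff)
qed

text \<open>Neither truncation binds:
  \<open>cost M H r \<le> cost M L r \<le> cost M L (r_hi M)\<close> keeps both costs below
  \<open>benefit M\<close>, and the lower bound on the smaller cost, that of \<open>H\<close>,
  carries over to \<open>L\<close>.\<close>

lemma completion_prob_interior:
  assumes lfr: "limited_feasible_recourse M" and r: "r \<in> requirements M"
    and H: "cost M H r > benefit M - noise M"
  shows "completion_prob M t r = (benefit M - cost M t r) / noise M"
proof -
  have "cost M L r \<le> cost M L (r_hi M)"
    using r by (intro cost_mono) (auto simp: requirements_def)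
  then have "cost M L r < benefit M" using lfr by (simp add: limited_feasible_recourse_def)
  then have "cost M t r < benefit M" "cost M t r > benefit M - noise M"
    using cost_le[OF r] H by (cases t; simp)+
  then show ?thesis using primitives_pos
    by (simp add: completion_prob_def min_def max_def divide_less_eq le_divide_eq field_simps)
qed

end

text \<open>\<open>r_star\<close> is any selection of maximizers at admissible productivities close
  to \<open>productivity M\<close>; uniqueness is imposed at \<open>productivity M\<close> itself.
  Since \<open>deriv\<close> has a value even where no derivative exists, \<open>Urr\<close> is
  accompanied by differentiability near the optimum.\<close>

theorem proposition5:
  fixes M :: primitives and p p_lo p_hi Urr :: real and r_star :: "real \<Rightarrow> real"
  assumes "screening_model M"
    and "limited_feasible_recourse M"
    and "acceptance_dominance M"
    and "cutoffs M p_lo p_hi"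
    and "p_lo < p" and "p < p_hi"
    and "\<forall>r. optimal_requirement M p r \<longleftrightarrow> r = r_star (productivity M)"
    and "r_star (productivity M) \<in> {r_lo M<..<r_hi M}"
    and "\<forall>\<^sub>F r in nhds (r_star (productivity M)). U_offer M p differentiable (at r)"
    and "(deriv (U_offer M p) has_real_derivative Urr) (at (r_star (productivity M)))"
    and "Urr < 0"
    and "\<forall>\<^sub>F d in at (productivity M) within admissible_productivities M.
           optimal_requirement (M\<lparr>productivity := d\<rparr>) p (r_star d)"
  shows "\<exists>D. (r_star has_real_derivative D) (at (productivity M) within admissible_productivities M) \<and>
    (p * gain M * deriv (cost M H) (r_star (productivity M))
       > (1 - p) * loss M * deriv (cost M L) (r_star (productivity M)) \<longrightarrow> D > 0) \<and>
    (p * gain M * deriv (cost M H) (r_star (productivity M))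
       < (1 - p) * loss M * deriv (cost M L) (r_star (productivity M)) \<longrightarrow> D < 0) \<and>
    (p * gain M * deriv (cost M H) (r_star (productivity M))
       = (1 - p) * loss M * deriv (cost M L) (r_star (productivity M)) \<longrightarrow> D = 0)"
proof -
  note model = assms(1) and lfr = assms(2) and r0 = assms(8)
  note pos = primitives_pos[OF model]
  \<comment> \<open>From \<open>0 < p_lo < p < p_hi \<le> 1\<close>.\<close>
  have p: "0 < p" "p < 1" using assms(4-6) by (auto simp: cutoffs_def)
  define d0 where "d0 = productivity M"
  define I where "I = {r_lo M<..<r_hi M}"
  have I_sub: "r \<in> requirements M" if "r \<in> I" for r
    using that by (auto simp: requirements_def I_def)
  obtain KH where KH: "\<And>r. r \<in> I \<Longrightarrow> (cost M H has_real_derivative KH r) (at r)"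
      "\<And>r. r \<in> I \<Longrightarrow> isCont KH r"
    unfolding I_def by (rule cost_derivE[OF model]) blast
  obtain KL where KL: "\<And>r. r \<in> I \<Longrightarrow> (cost M L has_real_derivative KL r) (at r)"
      "\<And>r. r \<in> I \<Longrightarrow> isCont KL r"
    unfolding I_def by (rule cost_derivE[OF model]) blast
  have r0I: "r_star d0 \<in> I" using r0 by (simp add: I_def d0_def)
  have opt: "optimal_requirement M p (r_star d0)" using assms(7) by (simp add: d0_def)
  \<comment> \<open>On \<open>N\<close> no completion probability is truncated. \<open>N\<close>
    does not involve productivity, so the derivative formula below serves every
    \<open>d\<close>.\<close>
  define N where "N = {r \<in> I. cost M H r > benefit M - noise M}"
  have r0N: "r_star d0 \<in> N"
    using optimal_requirement_cost_gt[OF model lfr p opt] r0 eventually_nhds_x_imp_x[OF assms(9)] r0I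
    by (simp add: N_def d0_def)
  have "continuous_on I (cost M H)"
    using KH(1) by (intro continuous_at_imp_continuous_on) (auto intro: DERIV_isCont)
  then have "open (I \<inter> cost M H -` {benefit M - noise M<..})"
    by (rule continuous_open_preimage) (auto simp: I_def)
  also have "I \<inter> cost M H -` {benefit M - noise M<..} = N"
    by (auto simp: N_def)
  finally have N_open: "open N" .
  define A where "A r = (p * (benefit M - cost M H r - r * KH r)
      + (1 - p) * (benefit M - cost M L r - r * KL r)) / noise M" for r
  define B where "B r = ((1 - p) * loss M * KL r - p * gain M * KH r) / noise M" for r
  have U_deriv: "(U_offer (M\<lparr>productivity := d\<rparr>) p has_real_derivative B r + d * A r) (at r)"
    if "r \<in> N" for d r
  proof (rule has_field_derivative_transform_within_open)
    have rI: "r \<in> I" using that by (simp add: N_def)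
    show "((\<lambda>r. p * ((benefit M - cost M H r) / noise M) * (gain M + d * r) +
        (1 - p) * ((benefit M - cost M L r) / noise M) * (- loss M + d * r))
        has_real_derivative B r + d * A r) (at r)"
      using pos by (auto intro!: derivative_eq_intros KH(1)[OF rI] KL(1)[OF rI]
          simp: A_def B_def field_simps)
    show "open N" "r \<in> N" by fact+
    fix s assume "s \<in> N"
    then have "completion_prob M t s = (benefit M - cost M t s) / noise M" for t
      using completion_prob_interior[OF model lfr I_sub] by (simp add: N_def)
    then show "p * ((benefit M - cost M H s) / noise M) * (gain M + d * s) +
        (1 - p) * ((benefit M - cost M L s) / noise M) * (- loss M + d * s) =
        U_offer (M\<lparr>productivity := d\<rparr>) p s"
      by (simp add: U_offer_def completion_prob_def)
  qed
  have foc: "B r + d * A r = 0"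
    if "r \<in> N" "optimal_requirement (M\<lparr>productivity := d\<rparr>) p r" for d r
    using interior_argmax_deriv_0[OF model U_deriv[OF that(1)]] that
    by (auto simp: optimal_requirement_iff[OF model] N_def I_def)
  have foc0: "B (r_star d0) + d0 * A (r_star d0) = 0"
    using foc[OF r0N, of d0] opt by (simp add: d0_def)
  \<comment> \<open>A feasible \<open>s\<close> doing as well as the optimum would be a second
    optimal requirement.\<close>
  have U_unique: "U_offer M p s < U_offer M p (r_star d0)"
    if "s \<in> requirements M" "s \<noteq> r_star d0" for s
  proof (rule ccontr)
    assume "\<not> ?thesis"
    then have "optimal_requirement M p s"
      using opt that(1) unfolding optimal_requirement_iff'[OF model] by force
    then show False using assms(7) that(2) by (simp add: d0_def)
  qed
  have lim: "(r_star \<longlongrightarrow> r_star d0) (at d0 within admissible_productivities M)"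
  proof (rule argmax_tendsto)
    show "compact (requirements M)" by (simp add: requirements_def)
    show "continuous_on (requirements M) (U_offer M p)" by (rule continuous_on_U_offer[OF model])
    show "uniform_limit (requirements M) (\<lambda>d. U_offer (M\<lparr>productivity := d\<rparr>) p) (U_offer M p)
        (at d0 within admissible_productivities M)"
      unfolding d0_def by (rule uniform_limit_U_offer[OF model]) (use p in auto)
    show "\<forall>\<^sub>F d in at d0 within admissible_productivities M. r_star d \<in> requirements M \<and>
        (\<forall>s\<in>requirements M. U_offer (M\<lparr>productivity := d\<rparr>) p s
          \<le> U_offer (M\<lparr>productivity := d\<rparr>) p (r_star d))"
      using assms(12) by (simp add: optimal_requirement_iff[OF model] d0_def)
  qed (use U_unique I_sub[OF r0I] in auto)
  \<comment> \<open>\<open>deriv (U_offer M p)\<close> agrees with the left side of the first-order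
    condition on the open set \<open>N\<close>, so the assumed second derivative passes to the
    latter.\<close>
  have second: "((\<lambda>r. B r + d0 * A r) has_real_derivative Urr) (at (r_star d0))"
  proof (rule has_field_derivative_transform_within_open)
    show "(deriv (U_offer M p) has_real_derivative Urr) (at (r_star d0))"
      using assms(10) by (simp add: d0_def)
    fix s assume "s \<in> N"
    from U_deriv[OF this, of d0] show "deriv (U_offer M p) s = B s + d0 * A s"
      by (simp add: d0_def DERIV_imp_deriv)
  qed (fact N_open r0N)+
  \<comment> \<open>Convergence brings \<open>r_star d\<close> into \<open>N\<close>, where the
    first-order condition at productivity \<open>d\<close> holds; splitting
    \<open>d = d0 + (d - d0)\<close> gives the shape needed for implicit differentiation.\<close>
  have "\<forall>\<^sub>F d in at d0 within admissible_productivities M. r_star d \<in> N"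
    using lim N_open r0N by (rule topological_tendstoD)
  with assms(12)[folded d0_def] have "\<forall>\<^sub>F d in at d0 within admissible_productivities M.
      B (r_star d) + d0 * A (r_star d) + (d - d0) * A (r_star d) = 0"
  proof eventually_elim
    case (elim d)
    then show ?case using foc[of "r_star d" d] by (simp add: algebra_simps)
  qed
  moreover have "isCont A (r_star d0)"
    unfolding A_def using pos KH[OF r0I] KL[OF r0I]
    by (intro continuous_intros) (auto intro: DERIV_isCont)
  ultimately have deriv: "(r_star has_real_derivative - A (r_star d0) / Urr)
      (at d0 within admissible_productivities M)"
    using implicit_has_real_derivative[where x = r_star and ?d0.0 = d0, OF second] assms(11) foc0 lim by simp
  define x where "x = p * gain M * deriv (cost M H) (r_star d0)"
  define y where "y = (1 - p) * loss M * deriv (cost M L) (r_star d0)"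
  have "deriv (cost M H) (r_star d0) = KH (r_star d0)" "deriv (cost M L) (r_star d0) = KL (r_star d0)"
    using KH(1)[OF r0I] KL(1)[OF r0I] by (auto simp: DERIV_imp_deriv)
  then have "d0 * A (r_star d0) = (x - y) / noise M"
    using foc0 by (simp add: B_def x_def y_def diff_divide_distrib)
  then have "A (r_star d0) = (x - y) / (noise M * d0)"
    using pos by (simp add: d0_def field_simps)
  \<comment> \<open>The minus sign moves to \<open>Urr < 0\<close>, making the denominator positive,
    so the derivative has the sign of \<open>x - y\<close>, zero included.\<close>
  then have D: "- A (r_star d0) / Urr = (x - y) / (noise M * d0 * (- Urr))"
    by simp
  moreover have "noise M * d0 * (- Urr) > 0"
    using pos assms(11) by (simp add: d0_def mult_pos_neg)
  ultimately show ?thesis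
    using deriv unfolding x_def[unfolded d0_def, symmetric] y_def[unfolded d0_def, symmetric]
    by (intro exI[of _ "- A (r_star d0) / Urr"]) (simp add: d0_def zero_less_divide_iff divide_less_0_iff)
qed

end
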